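(* Let $G$ be a closed subgroup of $\operatorname{GL}_2(\mathbb{Z}_2)$. (i) Suppose that $G(4)$ is trivial and $\det(g)\equiv 1\pmod 8$ for all $g\in G$. Then for every positive integer $n$: if $L(G)$ contains $2^{n}\mathfrak{sl}_2(\mathbb{Z}_2)$, then the derived subgroup $G'$ contains $\mathcal{B}_2(12n+2)$. (ii) Without any assumption on $G$, the subgroup \[ H=\ker (G \to G(4)) \cap \ker \left( G \to G(8) \xrightarrow{\det} (\mathbb{Z}/8\mathbb{Z})^\times \right) \] satisfies $[G:H] \leq 192$ and the conditions in (i).
   Context: $G(2^m)$ denotes the image of $G$ in $\operatorname{GL}_2(\mathbb{Z}/2^m\mathbb{Z})$. For a closed subgroup $G$ with trivial reduction mod $2$, $\Theta(g)=g-\frac{\operatorname{tr}(g)}{2}\operatorname{Id}\in\mathfrak{sl}_2(\mathbb{Z}_2)$ and $L(G)$ is the closed subgroup of $\mathfrak{sl}_2(\mathbb{Z}_2)$ (trace-zero matrices) topologically generated by $\Theta(G)$. $\mathcal{B}_2(n)=\{g\in\operatorname{SL}_2(\mathbb{Z}_2):g\equiv\operatorname{Id}\pmod{2^n}\}$. *)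

theory Defs
  imports "HOL-Analysis.Analysis" "HOL-Algebra.Generated_Groups"
begin

section \<open>The ring of 2-adic integers\<close>

text \<open>
  \<open>\<int>\<^sub>2\<close> is the inverse limit of the rings \<open>\<int>/2\<^sup>m\<close>.  The component \<open>residue x m\<close> is the canonical
  representative in \<open>{0..<2\<^sup>m}\<close> of \<open>x\<close> modulo \<open>2\<^sup>m\<close>; the range condition is implied by the
  compatibility condition.
\<close>

typedef padic2 = "{f :: nat \<Rightarrow> int. \<forall>m. f (Suc m) mod 2 ^ m = f m}"
  morphisms residue Abs_padic2
  by (rule exI[of _ "\<lambda>_. 0"]) simp

setup_lifting type_definition_padic2

lemma mod_pow2_Suc_mod: "(a mod 2 ^ Suc m) mod 2 ^ m = a mod (2 ^ m :: int)"
  by (rule mod_mod_cancel) simp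

lemma residue_Suc_mod: "residue x (Suc m) mod 2 ^ m = residue x m"
  using residue[of x] by simp

lemma residue_mod_self [simp]: "residue x m mod 2 ^ m = residue x m"
  by (metis residue_Suc_mod mod_mod_trivial)

lemma residue_mod_le: "k \<le> m \<Longrightarrow> residue x m mod 2 ^ k = residue x k"
proof (induction m rule: dec_induct)
  case (step m)
  have "residue x (Suc m) mod 2 ^ k = residue x (Suc m) mod 2 ^ m mod 2 ^ k"
    using step.hyps by (simp add: mod_mod_cancel le_imp_power_dvd)
  then show ?case
    using step.IH by (simp add: residue_Suc_mod)
qed simp

lemma residue_range: "residue x m \<in> {0..<2 ^ m}"
  by (metis residue_mod_self atLeastLessThan_iff pos_mod_sign pos_mod_bound zero_less_power
      zero_less_numeral)

instantiation padic2 :: comm_ring_1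
begin

lift_definition zero_padic2 :: padic2 is "\<lambda>_. 0" by simp

lift_definition one_padic2 :: padic2 is "\<lambda>m. 1 mod 2 ^ m"
  by (simp only: mod_pow2_Suc_mod)

lift_definition plus_padic2 :: "padic2 \<Rightarrow> padic2 \<Rightarrow> padic2" is "\<lambda>f g m. (f m + g m) mod 2 ^ m"
  by (simp only: mod_pow2_Suc_mod) (metis mod_add_eq)

lift_definition minus_padic2 :: "padic2 \<Rightarrow> padic2 \<Rightarrow> padic2" is "\<lambda>f g m. (f m - g m) mod 2 ^ m"
  by (simp only: mod_pow2_Suc_mod) (metis mod_diff_eq)

lift_definition uminus_padic2 :: "padic2 \<Rightarrow> padic2" is "\<lambda>f m. (- f m) mod 2 ^ m"
  by (simp only: mod_pow2_Suc_mod) (metis mod_minus_eq)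

lift_definition times_padic2 :: "padic2 \<Rightarrow> padic2 \<Rightarrow> padic2" is "\<lambda>f g m. (f m * g m) mod 2 ^ m"
  by (simp only: mod_pow2_Suc_mod) (metis mod_mult_eq)

instance
proof
  fix a b c :: padic2
  have self: "f m mod 2 ^ m = f m" if "\<forall>m. f (Suc m) mod 2 ^ m = f m"
    for f :: "nat \<Rightarrow> int" and m using that by (metis mod_mod_trivial)
  show "a * b * c = a * (b * c)"
    by transfer (simp add: mod_simps mult.assoc)
  show "a * b = b * a"
    by transfer (simp add: mult.commute)
  show "1 * a = a"
    by (transfer, rule ext, simp only: mod_mult_left_eq mult_1_left, rule self)
  show "a + b + c = a + (b + c)"
    by transfer (simp add: mod_simps add.assoc)
  show "a + b = b + a"
    by transfer (simp add: add.commute)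
  show "0 + a = a"
    by (transfer, rule ext, simp only: add_0_left, rule self)
  show "- a + a = 0"
    by transfer (simp add: mod_simps)
  show "a - b = a + - b"
    by transfer (simp add: mod_simps)
  show "(a + b) * c = a * c + b * c"
    by transfer (simp add: mod_simps distrib_right)
  show "(0 :: padic2) \<noteq> 1"
    by transfer (auto simp: fun_eq_iff intro!: exI[of _ 1])
qed

end

lemma residue_zero [simp]: "residue 0 m = 0"
  by transfer simp

lemma residue_one: "residue 1 m = 1 mod 2 ^ m"
  by transfer simp

lemma residue_add: "residue (x + y) m = (residue x m + residue y m) mod 2 ^ m"
  by transfer simp

lemma residue_mult: "residue (x * y) m = (residue x m * residue y m) mod 2 ^ m"
  by transfer simp

text \<open>The 2-adic topology.\<close>

instantiation padic2 :: topological_space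
begin

definition open_padic2 :: "padic2 set \<Rightarrow> bool" where
  "open_padic2 U \<longleftrightarrow> (\<forall>x\<in>U. \<exists>m. \<forall>y. 2 ^ m dvd y - x \<longrightarrow> y \<in> U)"

instance
proof
  show "open (UNIV :: padic2 set)"
    by (simp add: open_padic2_def)
next
  fix S T :: "padic2 set"
  assume S: "open S" and T: "open T"
  show "open (S \<inter> T)"
    unfolding open_padic2_def
  proof
    fix x assume x: "x \<in> S \<inter> T"
    obtain k where k: "\<And>y. 2 ^ k dvd y - x \<Longrightarrow> y \<in> S"
      using S x unfolding open_padic2_def by blast
    obtain l where l: "\<And>y. 2 ^ l dvd y - x \<Longrightarrow> y \<in> T"
      using T x unfolding open_padic2_def by blast
    have "y \<in> S \<inter> T" if "2 ^ (k + l) dvd y - x" for y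
      using that k l by (metis IntI dvd_mult_left dvd_mult_right power_add)
    then show "\<exists>m. \<forall>y. 2 ^ m dvd y - x \<longrightarrow> y \<in> S \<inter> T"
      by blast
  qed
next
  fix K :: "padic2 set set"
  assume "\<forall>S\<in>K. open S"
  then show "open (\<Union>K)"
    unfolding open_padic2_def by (meson Union_iff)
qed

end


section \<open>Matrix groups\<close>

definition GL2 :: "('a::comm_ring_1 ^ 2 ^ 2) monoid" where
  "GL2 = \<lparr>carrier = {A. invertible A}, mult = (**), one = mat 1\<rparr>"

definition unit_group :: "('a::comm_ring_1) monoid" where
  "unit_group = \<lparr>carrier = {u. u dvd 1}, mult = (*), one = 1\<rparr>"

text \<open>The additive group of trace-zero matrices.\<close>

definition sl2 :: "(padic2 ^ 2 ^ 2) monoid" where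
  "sl2 = \<lparr>carrier = {A. trace A = 0}, mult = (+), one = 0\<rparr>"

text \<open>
  The topology on matrices is the product topology of the library type of vectors.
\<close>

definition closed_subgroup :: "(padic2 ^ 2 ^ 2) monoid \<Rightarrow> (padic2 ^ 2 ^ 2) set \<Rightarrow> bool" where
  "closed_subgroup M G \<longleftrightarrow> subgroup G M \<and> closedin (top_of_set (carrier M)) G"

text \<open>
  Reduction modulo \<open>4\<close> and \<open>8\<close>.  The numeral types \<open>4\<close> and \<open>8\<close> are the rings
  \<open>\<int>/4\<int>\<close> and \<open>\<int>/8\<int>\<close>.
\<close>

definition mod4 :: "padic2 \<Rightarrow> 4" where
  "mod4 x = of_int (residue x 2)"

definition mod8 :: "padic2 \<Rightarrow> 8" where
  "mod8 x = of_int (residue x 3)"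

text \<open>\<open>B2 n\<close> is \<open>\<B>\<^sub>2(n)\<close>.\<close>

definition B2 :: "nat \<Rightarrow> (padic2 ^ 2 ^ 2) set" where
  "B2 n = {g. det g = 1 \<and> (\<forall>i j. 2 ^ n dvd (g - mat 1) $ i $ j)}"


section \<open>The Lie algebra attached to a group\<close>

text \<open>
  \<open>half x\<close> is meaningful only if \<open>2\<close> divides \<open>x\<close>.  This holds for the trace of every matrix that is
  trivial modulo \<open>2\<close>, and \<open>\<Theta>\<close> is used for such matrices only.
\<close>

definition half :: "padic2 \<Rightarrow> padic2" where
  "half x = (THE y. 2 * y = x)"

lemma half_unique:
  assumes "2 * y = 2 * (z :: padic2)" shows "y = z"
proof -
  have "residue y m = residue z m" for m
  proof -
    have two: "residue (2 * w) (Suc m) = 2 * residue w m" for w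
    proof -
      have "residue (2 * w) (Suc m) = residue (w + w) (Suc m)"
        by (simp only: mult_2)
      also have "\<dots> = (2 * residue w (Suc m)) mod (2 * 2 ^ m)"
        by (simp only: residue_add mult_2[of "residue w (Suc m)"] power_Suc)
      also have "\<dots> = 2 * residue w m"
        by (simp only: mult_mod_right[symmetric] residue_Suc_mod)
      finally show ?thesis .
    qed
    show ?thesis
      using two[of y] two[of z] assms by simp
  qed
  then show ?thesis
    by (metis residue_inject ext)
qed

lemma half_double [simp]: "half (2 * y) = y"
  unfolding half_def using half_unique by blast

definition Theta :: "padic2 ^ 2 ^ 2 \<Rightarrow> padic2 ^ 2 ^ 2" where
  "Theta g = g - mat (half (trace g))"

definition L :: "(padic2 ^ 2 ^ 2) set \<Rightarrow> (padic2 ^ 2 ^ 2) set" where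
  "L G = \<Inter>{K. closed_subgroup sl2 K \<and> Theta ` G \<subseteq> K}"


section \<open>The congruence conditions\<close>

text \<open>The first condition says that \<open>G(4)\<close> is trivial, the second that \<open>det\<close> is \<open>1\<close> modulo \<open>8\<close>.\<close>

definition congruence_conditions :: "(padic2 ^ 2 ^ 2) set \<Rightarrow> bool" where
  "congruence_conditions G \<longleftrightarrow>
     map_matrix mod4 ` G = {mat 1} \<and> (\<forall>g\<in>G. 8 dvd det g - 1)"

definition congruence_kernel :: "(padic2 ^ 2 ^ 2) set \<Rightarrow> (padic2 ^ 2 ^ 2) set" where
  "congruence_kernel G =
     kernel (GL2\<lparr>carrier := G\<rparr>) GL2 (map_matrix mod4) \<inter>
     kernel (GL2\<lparr>carrier := G\<rparr>) unit_group (\<lambda>g. det (map_matrix mod8 g))"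

end

theory Submission
  imports Defs "HOL-Number_Theory.Cong"
begin

text \<open>
  For \<open>g\<close> in \<open>G\<close> write \<open>g = t + x\<close> with \<open>t\<close> an odd scalar and \<open>x = \<Theta>(g)\<close>; as \<open>x\<^sup>2\<close> is scalar, the
  \<open>2\<^sup>a\<close>-th power of \<open>g\<close> is \<open>s + 2\<^sup>a u x\<close> with \<open>s\<close>, \<open>u\<close> odd scalars.  The commutator of two such powers
  is \<open>1 + 2\<^sup>2\<^sup>a v [\<Theta>(g), \<Theta>(h)]\<close> modulo \<open>2\<^sup>3\<^sup>a\<close>, again with an odd scalar \<open>v\<close>.  The \<open>X\<close> such that
  \<open>1 + 2\<^sup>2\<^sup>a X\<close> is congruent modulo \<open>2\<^sup>3\<^sup>a\<close> to an element of \<open>G'\<close> form an open submodule, which therefore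
  contains \<open>[L(G), L(G)]\<close> and so \<open>2\<^sup>2\<^sup>n\<^sup>+\<^sup>1 sl\<^sub>2\<close>.  For \<open>a = 4 n\<close> this realises every first-order
  term at level \<open>10 n + 1\<close>, by squaring also at every higher level, and \<open>G'\<close> is dense in
  \<open>\<B>\<^sub>2(10 n + 1)\<close>.

  Since \<open>G'\<close> is the abstract commutator subgroup, its closedness has to be shown: \<open>G\<close> is closed, so it
  contains \<open>\<B>\<^sub>2(10 n + 1)\<close>; commutators of diagonal and elementary matrices are elementary, and
  elementary matrices generate a congruence subgroup.  Hence \<open>G'\<close> is open.
\<close>

section \<open>Arithmetic of 2-adic integers\<close>

lemma padic2_eqI: "(\<And>m. residue x m = residue y m) \<Longrightarrow> x = y"
  by (metis residue_inject ext)

lemma residue_diff: "residue (x - y) m = (residue x m - residue y m) mod 2 ^ m"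
  by transfer simp

lemma residue_of_nat: "residue (of_nat k) m = int k mod 2 ^ m"
  by (induction k) (simp_all add: residue_add residue_one mod_simps add.commute)

lemma residue_of_int: "residue (of_int z) m = z mod 2 ^ m"
proof (cases z rule: int_cases2)
  case (nonneg n)
  then show ?thesis by (simp add: residue_of_nat)
next
  case (nonpos n)
  have "residue (0 - of_nat n) m = (- int n) mod 2 ^ m"
    using residue_diff[of 0 "of_nat n" m] by (simp add: residue_of_nat mod_minus_eq)
  then show ?thesis
    using nonpos by simp
qed

lemma residue_two_power: "residue (2 ^ n) m = 2 ^ n mod 2 ^ m"
  using residue_of_int[of "2 ^ n"] by simp

text \<open>The quotient by \<open>2 ^ m\<close> is built by shifting: its residue modulo
  \<open>2 ^ k\<close> is \<open>residue x (m + k) div 2 ^ m\<close>.\<close>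

lemma power2_dvd_iff: "2 ^ m dvd x \<longleftrightarrow> residue x m = 0"
proof
  assume "2 ^ m dvd x"
  then show "residue x m = 0"
    by (elim dvdE) (simp add: residue_mult residue_two_power)
next
  assume x: "residue x m = 0"
  define f where "f k = residue x (m + k) div 2 ^ m" for k
  have f: "f (Suc k) mod 2 ^ k = f k" for k
  proof -
    have "f (Suc k) mod 2 ^ k = residue x (m + Suc k) mod 2 ^ (m + k) div 2 ^ m"
    proof -
      have "z mod (a * b) div a = z div a mod b" if "a > 0" "b > 0" for z a b :: int
        using that by (simp add: zmod_zmult2_eq)
      then show ?thesis
        by (simp add: f_def power_add)
    qed
    also have "residue x (m + Suc k) mod 2 ^ (m + k) = residue x (m + k)"
      by (rule residue_mod_le) simp
    finally show ?thesis by (simp add: f_def)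
  qed
  define y where "y = Abs_padic2 f"
  have y: "residue y k = f k" for k
    using f by (simp add: y_def Abs_padic2_inverse)
  have "x = 2 ^ m * y"
  proof (rule padic2_eqI)
    fix k
    have "residue x (m + k) mod 2 ^ m = 0"
      using residue_mod_le[of m "m + k" x] x by simp
    then have "2 ^ m * f k = residue x (m + k)"
      by (simp add: f_def mod_0_imp_dvd)
    moreover have "residue (2 ^ m * y) k = (2 ^ m * f k) mod 2 ^ k"
      by (simp add: residue_mult residue_two_power y mod_simps)
    ultimately show "residue x k = residue (2 ^ m * y) k"
      by (simp add: residue_mod_le)
  qed
  then show "2 ^ m dvd x" by simp
qed

lemma power2_dvd_diff_iff: "2 ^ m dvd x - y \<longleftrightarrow> residue x m = residue y m"
proof -
  have "2 ^ m dvd x - y \<longleftrightarrow> (residue x m - residue y m) mod 2 ^ m = 0"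
    by (simp add: power2_dvd_iff residue_diff)
  also have "\<dots> \<longleftrightarrow> residue x m mod 2 ^ m = residue y m mod 2 ^ m"
    by (simp only: mod_eq_dvd_iff dvd_eq_mod_eq_0)
  finally show ?thesis by simp
qed

lemma dvd_diff_residue: "2 ^ m dvd x - of_int (residue x m)"
  by (simp add: power2_dvd_diff_iff residue_of_int)

lemma two_not_dvd_one: "\<not> 2 dvd (1 :: padic2)"
  using power2_dvd_iff[of 1 1] by (simp add: residue_one)

text \<open>An odd element is invertible modulo every \<open>2 ^ m\<close>; inverses modulo
  \<open>2 ^ m\<close> are unique, hence compatible, and define a 2-adic integer.\<close>

lemma dvd_one_iff_odd: "x dvd 1 \<longleftrightarrow> \<not> 2 dvd (x :: padic2)"
proof
  assume "x dvd 1"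
  then show "\<not> 2 dvd x"
    using two_not_dvd_one dvd_trans by blast
next
  assume "\<not> 2 dvd x"
  \<comment> \<open>Stated at \<open>Suc m\<close> because \<open>residue x 0\<close> is always
    0.\<close>
  then have odd: "odd (residue x (Suc m))" for m
    using power2_dvd_iff[of 1 x] residue_mod_le[of 1 "Suc m" x] by (simp add: odd_iff_mod_2_eq_one even_iff_mod_2_eq_zero)
  have "\<exists>i. (residue x m * i) mod 2 ^ m = 1 mod 2 ^ m" for m
  proof (cases m)
    case (Suc k)
    have "coprime (residue x m) (2 ^ m)"
      using odd[of k] Suc by simp
    then show ?thesis
      using cong_solve_coprime_int unfolding cong_def by blast
  qed simp
  then obtain i where i: "\<And>m. (residue x m * i m) mod 2 ^ m = 1 mod 2 ^ m"
    by metis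
  define f where "f m = i m mod 2 ^ m" for m
  have f: "(residue x m * f m) mod 2 ^ m = 1 mod 2 ^ m" for m
    using i by (simp add: f_def mod_simps)
  have "f (Suc m) mod 2 ^ m = f m" for m
  proof (cases m)
    case 0
    then show ?thesis by (simp add: f_def)
  next
    case (Suc k)
    have "(residue x m * f (Suc m)) mod 2 ^ m = (residue x (Suc m) * f (Suc m)) mod 2 ^ Suc m mod 2 ^ m"
      by (metis mod_pow2_Suc_mod mod_mult_left_eq residue_Suc_mod)
    also have "\<dots> = (residue x m * f m) mod 2 ^ m"
      by (metis f mod_pow2_Suc_mod)
    finally have "[residue x m * f (Suc m) = residue x m * f m] (mod 2 ^ m)"
      by (simp add: cong_def)
    moreover have "coprime (residue x m) (2 ^ m)"
      using odd[of k] Suc by simp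
    ultimately have "[f (Suc m) = f m] (mod 2 ^ m)"
      by (simp add: cong_mult_lcancel)
    then show ?thesis
      by (simp add: cong_def f_def)
  qed
  then have "residue (Abs_padic2 f) m = f m" for m
    by (simp add: Abs_padic2_inverse)
  then have "x * Abs_padic2 f = 1"
    by (intro padic2_eqI) (simp add: residue_mult f residue_one)
  then show "x dvd 1"
    by (metis dvdI)
qed

lemma odd_inverse: "\<not> 2 dvd x \<Longrightarrow> \<exists>y. x * y = (1 :: padic2)"
  unfolding dvd_one_iff_odd[symmetric] by (auto elim!: dvdE)

lemma odd_times: "\<not> 2 dvd x \<Longrightarrow> \<not> 2 dvd y \<Longrightarrow> \<not> 2 dvd x * (y :: padic2)"
  using mult_dvd_mono[of x 1 y 1] by (simp add: dvd_one_iff_odd)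

lemma odd_plus_even: "\<not> 2 dvd x \<Longrightarrow> 2 dvd y \<Longrightarrow> \<not> 2 dvd x + (y :: padic2)"
  by (simp add: dvd_add_left_iff)

lemma odd_one_plus: "1 \<le> k \<Longrightarrow> 2 ^ k dvd x \<Longrightarrow> \<not> 2 dvd 1 + (x :: padic2)"
  using le_imp_power_dvd[of 1 k "2 :: padic2"] dvd_trans[of 2 "2 ^ k" x] odd_plus_even[OF two_not_dvd_one]
  by simp

section \<open>Matrices of size two\<close>

lemma all_2_matrix: "(\<forall>(i::2) (j::2). P i j) \<longleftrightarrow> P 1 1 \<and> P 1 2 \<and> P 2 1 \<and> P 2 2"
  by (auto simp: forall_2)

lemma matrix_2_eq_iff:
  "A = (B :: 'a ^ 2 ^ 2) \<longleftrightarrow>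
    A$1$1 = B$1$1 \<and> A$1$2 = B$1$2 \<and> A$2$1 = B$2$1 \<and> A$2$2 = B$2$2"
  by (simp add: vec_eq_iff forall_2)

lemma mat_nth: "mat c $ i $ j = (if i = j then c else 0)"
  by (simp add: mat_def)

lemma trace_2: "trace (A :: 'a::comm_ring_1 ^ 2 ^ 2) = A$1$1 + A$2$2"
  by (simp add: trace_def sum_2)

lemma matrix_mul_2: "((A :: 'a::comm_ring_1 ^ 2 ^ 2) ** B) $ i $ j = A$i$1 * B$1$j + A$i$2 * B$2$j"
  by (simp add: matrix_matrix_mult_def sum_2)

lemma matrix_add_rdistrib_2: "((A :: 'a::comm_ring_1 ^ 2 ^ 2) + B) ** (C :: 'a ^ 2 ^ 2) = A ** C + B ** C"
  by (simp add: matrix_2_eq_iff matrix_mul_2 algebra_simps)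

definition mat2 :: "'a \<Rightarrow> 'a \<Rightarrow> 'a \<Rightarrow> 'a \<Rightarrow> 'a ^ 2 ^ 2" where
  "mat2 a b c d = (\<chi> i j. if i = 1 then if j = 1 then a else b else if j = 1 then c else d)"

lemma mat2_nth [simp]:
  "mat2 a b c d $ 1 $ 1 = a" "mat2 a b c d $ 1 $ 2 = b"
  "mat2 a b c d $ 2 $ 1 = c" "mat2 a b c d $ 2 $ 2 = d"
  by (simp_all add: mat2_def)

lemmas mat2_simps = matrix_2_eq_iff matrix_mul_2 mat_nth trace_2 det_2

text \<open>An abbreviation, so that scalar multiples remain literally the \<open>map_matrix\<close>
  terms of the theorem.\<close>

abbreviation (input) scale :: "'a::times \<Rightarrow> 'a ^ 'n ^ 'm \<Rightarrow> 'a ^ 'n ^ 'm" where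
  "scale c \<equiv> map_matrix ((*) c)"

definition bracket :: "'a::comm_ring_1 ^ 2 ^ 2 \<Rightarrow> 'a ^ 2 ^ 2 \<Rightarrow> 'a ^ 2 ^ 2" where
  "bracket X Y = X ** Y - Y ** X"

definition mcong :: "nat \<Rightarrow> padic2 ^ 2 ^ 2 \<Rightarrow> padic2 ^ 2 ^ 2 \<Rightarrow> bool" where
  "mcong m A B \<longleftrightarrow> (\<forall>i j. 2 ^ m dvd (A - B) $ i $ j)"

text \<open>Replaces a congruence by an equation with an explicit error matrix, so that later
  congruences follow from polynomial identities.\<close>

lemma mcong_iff: "mcong m A B \<longleftrightarrow> (\<exists>C. A = B + scale (2 ^ m) C)"
proof
  assume "mcong m A B"
  then obtain C where C: "\<And>i j. (A - B) $ i $ j = 2 ^ m * C i j"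
    unfolding mcong_def dvd_def by metis
  have "A = B + scale (2 ^ m) (\<chi> i j. C i j)"
    using C by (simp add: vec_eq_iff algebra_simps)
  then show "\<exists>C. A = B + scale (2 ^ m) C" by blast
qed (auto simp: mcong_def)

lemma mcong_refl [simp]: "mcong m A A"
  by (simp add: mcong_def)

lemma mcong_sym: "mcong m A B \<Longrightarrow> mcong m B A"
  unfolding mcong_def
proof (intro allI)
  fix i j
  assume "\<forall>i j. 2 ^ m dvd (A - B) $ i $ j"
  then have "2 ^ m dvd (A - B) $ i $ j"
    by blast
  then have "2 ^ m dvd - ((A - B) $ i $ j)"
    by (simp only: dvd_minus_iff)
  then show "2 ^ m dvd (B - A) $ i $ j" by simp
qed

lemma mcong_trans [trans]: "mcong m A B \<Longrightarrow> mcong m B C \<Longrightarrow> mcong m A C"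
  unfolding mcong_def
proof (intro allI)
  fix i j
  assume "\<forall>i j. 2 ^ m dvd (A - B) $ i $ j" "\<forall>i j. 2 ^ m dvd (B - C) $ i $ j"
  then have "2 ^ m dvd (A - B) $ i $ j + (B - C) $ i $ j"
    by (intro dvd_add) auto
  then show "2 ^ m dvd (A - C) $ i $ j" by simp
qed

lemma mcong_mono: "mcong m A B \<Longrightarrow> k \<le> m \<Longrightarrow> mcong k A B"
  unfolding mcong_def using le_imp_power_dvd dvd_trans by blast

lemma mcong_add: "mcong m A B \<Longrightarrow> mcong m C D \<Longrightarrow> mcong m (A + C) (B + D)"
  unfolding mcong_def by (simp add: add_diff_add dvd_add)

lemma mcong_mult:
  assumes "mcong m A B" "mcong m C D" shows "mcong m (A ** C) (B ** D)"
proof -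
  obtain X Y where "A = B + scale (2 ^ m) X" "C = D + scale (2 ^ m) Y"
    using assms unfolding mcong_iff by blast
  then have "A ** C = B ** D + scale (2 ^ m) (B ** Y + X ** D + scale (2 ^ m) (X ** Y))"
    by (simp add: mat2_simps algebra_simps)
  then show ?thesis
    unfolding mcong_iff by blast
qed

lemma mcong_scale_power: "mcong m A B \<Longrightarrow> mcong (k + m) (scale (2 ^ k) A) (scale (2 ^ k) B)"
  unfolding mcong_def by (simp add: power_add mult_dvd_mono flip: right_diff_distrib)

lemma mcong_scale: "mcong m A B \<Longrightarrow> mcong m (scale c A) (scale c B)"
  unfolding mcong_def by (simp flip: right_diff_distrib)

lemma B2_iff: "g \<in> B2 m \<longleftrightarrow> det g = 1 \<and> mcong m g (mat 1)"
  by (simp add: B2_def mcong_def)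

lemma B2_mono: "k \<le> m \<Longrightarrow> B2 m \<subseteq> B2 k"
  by (auto simp: B2_iff intro: mcong_mono)

lemma mat2_in_B2:
  assumes "a * d - b * c = 1" "2 ^ m dvd a - 1" "2 ^ m dvd b" "2 ^ m dvd c" "2 ^ m dvd d - 1"
  shows "mat2 a b c d \<in> B2 m"
  using assms by (simp add: B2_def det_2 forall_2 mat_nth)

section \<open>The topology on matrices\<close>

lemma open_padic2_ball: "open {y :: padic2. 2 ^ m dvd y - x}"
  unfolding open_padic2_def
proof clarify
  fix z :: padic2 assume "2 ^ m dvd z - x"
  then have "2 ^ m dvd y - x" if "2 ^ m dvd y - z" for y
    using dvd_add[OF that \<open>2 ^ m dvd z - x\<close>] by simp
  then show "\<exists>k. \<forall>y. 2 ^ k dvd y - z \<longrightarrow> y \<in> {y. 2 ^ m dvd y - x}"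
    by blast
qed

text \<open>The product topology is nested, rows outside and entries inside. The exponents for the
  four entries have a common bound, so congruence classes form a base.\<close>

lemma open_matrix_iff:
  fixes S :: "(padic2 ^ 2 ^ 2) set"
  shows "open S \<longleftrightarrow> (\<forall>A\<in>S. \<exists>m. \<forall>B. mcong m B A \<longrightarrow> B \<in> S)"
proof
  assume S: "open S"
  show "\<forall>A\<in>S. \<exists>m. \<forall>B. mcong m B A \<longrightarrow> B \<in> S"
  proof
    fix A assume "A \<in> S"
    then obtain U where U: "\<And>i. open (U i)" "\<And>i. A $ i \<in> U i" "\<And>B. \<forall>i. B $ i \<in> U i \<Longrightarrow> B \<in> S"
      using S unfolding open_vec_def[of S] by metis
    have "\<exists>V. (\<forall>j. open (V j) \<and> A $ i $ j \<in> V j) \<and> (\<forall>s. (\<forall>j. s $ j \<in> V j) \<longrightarrow> s \<in> U i)" for i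
    proof -
      have "\<forall>r\<in>U i. \<exists>V. (\<forall>j. open (V j) \<and> r $ j \<in> V j) \<and> (\<forall>s. (\<forall>j. s $ j \<in> V j) \<longrightarrow> s \<in> U i)"
        using U(1)[of i] by (simp only: open_vec_def)
      then show ?thesis
        using U(2)[of i] by (rule bspec)
    qed
    then obtain V where V: "\<And>i j. open (V i j)" "\<And>i j. A $ i $ j \<in> V i j"
        "\<And>i r. \<forall>j. r $ j \<in> V i j \<Longrightarrow> r \<in> U i"
      by metis
    have "\<exists>m. \<forall>y. 2 ^ m dvd y - A $ i $ j \<longrightarrow> y \<in> V i j" for i j
      using V(1,2) unfolding open_padic2_def by blast
    then obtain m where m: "\<And>i j y. 2 ^ m i j dvd y - A $ i $ j \<Longrightarrow> y \<in> V i j"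
      by metis
    define M where "M = m 1 1 + m 1 2 + m 2 1 + m 2 2"
    have M: "m i j \<le> M" for i j
      using exhaust_2[of i] exhaust_2[of j] by (auto simp: M_def)
    have "B \<in> S" if "mcong M B A" for B
    proof (intro U(3) allI V(3) m)
      fix i j
      have "mcong (m i j) B A"
        using that M by (rule mcong_mono)
      then show "2 ^ m i j dvd B $ i $ j - A $ i $ j"
        by (simp add: mcong_def)
    qed
    then show "\<exists>m. \<forall>B. mcong m B A \<longrightarrow> B \<in> S" by blast
  qed
next
  assume S: "\<forall>A\<in>S. \<exists>m. \<forall>B. mcong m B A \<longrightarrow> B \<in> S"
  show "open S"
    unfolding open_vec_def[of S]
  proof
    fix A assume "A \<in> S"
    then obtain m where m: "\<And>B. mcong m B A \<Longrightarrow> B \<in> S"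
      using S by blast
    define U where "U i = {r :: padic2 ^ 2. \<forall>j. r $ j \<in> {y. 2 ^ m dvd y - A $ i $ j}}" for i
    have "open (U i)" for i
      unfolding open_vec_def
    proof
      fix r assume r: "r \<in> U i"
      show "\<exists>V. (\<forall>j. open (V j) \<and> r $ j \<in> V j) \<and> (\<forall>y. (\<forall>j. y $ j \<in> V j) \<longrightarrow> y \<in> U i)"
        using r by (intro exI[of _ "\<lambda>j. {y. 2 ^ m dvd y - A $ i $ j}"])
          (auto simp: U_def open_padic2_ball)
    qed
    moreover have "B \<in> S" if "\<forall>i. B $ i \<in> U i" for B
      using that by (intro m) (simp add: U_def mcong_def)
    ultimately show "\<exists>U. (\<forall>i. open (U i) \<and> A $ i \<in> U i) \<and> (\<forall>y. (\<forall>i. y $ i \<in> U i) \<longrightarrow> y \<in> S)"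
      by (intro exI[of _ U]) (auto simp: U_def)
  qed
qed

text \<open>The complement is a union of congruence classes modulo \<open>2 ^ m\<close> as well,
  hence open.\<close>

lemma closed_if_mcong_invariant:
  assumes "\<And>A B. A \<in> S \<Longrightarrow> mcong m A B \<Longrightarrow> B \<in> S"
  shows "closed S"
  unfolding closed_def open_matrix_iff using assms by blast

text \<open>Otherwise some congruence class of \<open>A\<close> would avoid the closed set that cuts
  out \<open>S\<close>. This turns approximation by commutators into membership in
  \<open>G\<close>.\<close>

lemma closedin_approx:
  assumes "closedin (top_of_set X) S" "A \<in> X" "\<And>m. \<exists>B\<in>S. mcong m B A"
  shows "A \<in> S"
proof (rule ccontr)
  assume A: "A \<notin> S"
  obtain T where T: "closed T" "S = X \<inter> T"
    using assms(1) unfolding closedin_closed by blast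
  then have "A \<in> - T" "open (- T)"
    using A assms(2) by auto
  then obtain m where "\<And>B. mcong m B A \<Longrightarrow> B \<in> - T"
    unfolding open_matrix_iff by blast
  then show False
    using assms(3)[of m] T(2) by blast
qed

section \<open>The groups involved\<close>

lemma carrier_GL2: "carrier GL2 = {A. invertible A}"
  and mult_GL2 [simp]: "A \<otimes>\<^bsub>GL2\<^esub> B = A ** B"
  and one_GL2 [simp]: "\<one>\<^bsub>GL2\<^esub> = mat 1"
  by (simp_all add: GL2_def)

lemma group_GL2: "group (GL2 :: ('a::comm_ring_1 ^ 2 ^ 2) monoid)"
proof (rule groupI)
  fix A :: "'a ^ 2 ^ 2" assume "A \<in> carrier GL2"
  then show "\<exists>B\<in>carrier GL2. B \<otimes>\<^bsub>GL2\<^esub> A = \<one>\<^bsub>GL2\<^esub>"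
    by (force simp: carrier_GL2 invertible_def)
qed (simp_all add: carrier_GL2 invertible_mult matrix_mul_assoc, auto simp: invertible_def)

lemma carrier_sl2: "carrier sl2 = {A. trace A = 0}"
  and mult_sl2 [simp]: "A \<otimes>\<^bsub>sl2\<^esub> B = A + B"
  and one_sl2 [simp]: "\<one>\<^bsub>sl2\<^esub> = 0"
  by (simp_all add: sl2_def)

lemma group_sl2: "group sl2"
proof (rule groupI)
  fix A assume "A \<in> carrier sl2"
  then show "\<exists>B\<in>carrier sl2. B \<otimes>\<^bsub>sl2\<^esub> A = \<one>\<^bsub>sl2\<^esub>"
    by (intro bexI[of _ "- A"]) (auto simp: carrier_sl2 trace_def sum_negf)
qed (auto simp: carrier_sl2 trace_2 algebra_simps)

lemma inv_sl2: "A \<in> carrier sl2 \<Longrightarrow> inv\<^bsub>sl2\<^esub> A = - A"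
  by (rule group.inv_equality[OF group_sl2]) (auto simp: carrier_sl2 trace_def sum_negf)

lemma inv_GL2:
  assumes "A \<in> carrier GL2"
  shows "A ** inv\<^bsub>GL2\<^esub> A = mat 1" "inv\<^bsub>GL2\<^esub> A ** A = mat 1"
  using group.r_inv[OF group_GL2 assms] group.l_inv[OF group_GL2 assms] by simp_all

lemma det_inv_GL2:
  fixes A :: "'a::comm_ring_1 ^ 2 ^ 2"
  assumes "A \<in> carrier GL2"
  shows "det A * det (inv\<^bsub>GL2\<^esub> A) = 1"
  using inv_GL2(1)[OF assms] by (metis det_I det_mul)

text \<open>The adjugate is a two-sided inverse.\<close>

lemma det_one_in_GL2:
  assumes "det A = (1 :: 'a::comm_ring_1)"
  shows "A \<in> carrier GL2"
proof -
  have "A ** mat2 (A$2$2) (- A$1$2) (- A$2$1) (A$1$1) = mat 1"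
    "mat2 (A$2$2) (- A$1$2) (- A$2$1) (A$1$1) ** A = mat 1"
    using assms by (simp_all add: mat2_simps algebra_simps)
  then show ?thesis
    by (auto simp: carrier_GL2 invertible_def)
qed

lemma inv_GL2_eq_mat2:
  assumes "a * d - b * c = (1 :: 'a::comm_ring_1)"
  shows "inv\<^bsub>GL2\<^esub> (mat2 a b c d) = mat2 d (- b) (- c) a"
  using assms
  by (intro group.inv_equality[OF group_GL2] det_one_in_GL2) (simp_all add: mat2_simps algebra_simps)

section \<open>Open submodules of the matrix algebra\<close>

text \<open>These are the submodules of the full matrix algebra that contain \<open>2 ^ m\<close>
  times it: given additivity and 0, this is equivalent to the last clause.\<close>

definition open_submodule :: "nat \<Rightarrow> (padic2 ^ 2 ^ 2) set \<Rightarrow> bool" where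
  "open_submodule m T \<longleftrightarrow>
     0 \<in> T \<and> (\<forall>X\<in>T. \<forall>Y\<in>T. X + Y \<in> T) \<and> (\<forall>c. \<forall>X\<in>T. scale c X \<in> T) \<and>
     (\<forall>X Y. X \<in> T \<longrightarrow> mcong m X Y \<longrightarrow> Y \<in> T)"

text \<open>Makes the trace-zero part of \<open>T\<close> eligible for the intersection that defines
  \<open>L\<close>. Closedness comes from invariance under congruence modulo
  \<open>2 ^ m\<close>.\<close>

lemma closed_subgroup_open_submodule:
  assumes "open_submodule m T"
  shows "closed_subgroup sl2 (carrier sl2 \<inter> T)"
proof -
  have "- X = scale (- 1) X" for X :: "padic2 ^ 2 ^ 2"
    by (simp add: vec_eq_iff)
  then have "- X \<in> T" if "X \<in> T" for X
    using that assms unfolding open_submodule_def by metis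
  moreover have "- X \<in> carrier sl2" if "X \<in> carrier sl2" for X
    using that by (simp add: carrier_sl2 trace_def sum_negf)
  moreover have "0 \<in> T" "0 \<in> carrier sl2"
    using assms group.is_monoid[OF group_sl2, THEN monoid.one_closed] by (auto simp: open_submodule_def)
  ultimately have "subgroup (carrier sl2 \<inter> T) sl2"
    using assms
    by (intro group.subgroupI[OF group_sl2])
      (auto simp: open_submodule_def inv_sl2 carrier_sl2 trace_add)
  moreover have "closed T"
    using assms unfolding open_submodule_def by (intro closed_if_mcong_invariant) blast
  ultimately show ?thesis
    unfolding closed_subgroup_def closedin_closed by blast
qed

lemma L_subset_open_submodule:
  assumes "open_submodule m T" "Theta ` G \<subseteq> carrier sl2 \<inter> T"
  shows "L G \<subseteq> T"
  using assms closed_subgroup_open_submodule unfolding L_def by blast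

text \<open>Bracketing with a fixed matrix is linear and respects congruences modulo
  \<open>2 ^ m\<close>, so preimages of \<open>T\<close> inherit all clauses.\<close>

lemma open_submodule_bracket:
  assumes "open_submodule m T"
  shows "open_submodule m {Y. bracket X Y \<in> T}" "open_submodule m {X. bracket X Y \<in> T}"
proof -
  have "bracket X 0 = 0" "bracket 0 X = 0" for X :: "padic2 ^ 2 ^ 2"
    by (simp_all add: bracket_def mat2_simps)
  moreover have "bracket X (Y + Z) = bracket X Y + bracket X Z"
    "bracket (Y + Z) X = bracket Y X + bracket Z X"
    "bracket X (scale c Y) = scale c (bracket X Y)"
    "bracket (scale c Y) X = scale c (bracket Y X)" for X Y Z :: "padic2 ^ 2 ^ 2" and c
    by (simp_all add: bracket_def mat2_simps algebra_simps)
  moreover have "mcong m (bracket X Y) (bracket X Z)" "mcong m (bracket Y X) (bracket Z X)"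
    if "mcong m Y Z" for X Y Z
  proof -
    obtain C where "Y = Z + scale (2 ^ m) C"
      using \<open>mcong m Y Z\<close> unfolding mcong_iff by blast
    then have "bracket X Y = bracket X Z + scale (2 ^ m) (bracket X C)"
      "bracket Y X = bracket Z X + scale (2 ^ m) (bracket C X)"
      by (simp_all add: bracket_def mat2_simps algebra_simps)
    then show "mcong m (bracket X Y) (bracket X Z)" "mcong m (bracket Y X) (bracket Z X)"
      unfolding mcong_iff by blast+
  qed
  ultimately show "open_submodule m {Y. bracket X Y \<in> T}" "open_submodule m {X. bracket X Y \<in> T}"
    using assms unfolding open_submodule_def mem_Collect_eq by simp_all
qed

lemma bracket_L_subset_open_submodule:
  assumes T: "open_submodule m T" and G: "Theta ` G \<subseteq> carrier sl2"
    and bracket: "\<And>g h. g \<in> G \<Longrightarrow> h \<in> G \<Longrightarrow> bracket (Theta g) (Theta h) \<in> T"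
    and X: "X \<in> L G" and Y: "Y \<in> L G"
  shows "bracket X Y \<in> T"
proof -
  have "L G \<subseteq> {Y. bracket (Theta g) Y \<in> T}" if "g \<in> G" for g
    using that by (intro L_subset_open_submodule[OF open_submodule_bracket(1)[OF T]]) (use G bracket in auto)
  then have "L G \<subseteq> {X. bracket X Y \<in> T}"
    using Y by (intro L_subset_open_submodule[OF open_submodule_bracket(2)[OF T]]) (use G in auto)
  then show ?thesis
    using X by blast
qed

section \<open>First-order approximation of a matrix group\<close>

text \<open>
  The terms \<open>2 ^ r * X\<close> with \<open>1 + 2 ^ r * X\<close> congruent modulo \<open>2 ^ (r + m)\<close> to an element of \<open>D\<close>.
  If \<open>m \<le> r\<close>, the quadratic terms of products vanish modulo \<open>2 ^ (r + m)\<close>, so the set is additive.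
\<close>

definition tangent :: "(padic2 ^ 2 ^ 2) set \<Rightarrow> nat \<Rightarrow> nat \<Rightarrow> (padic2 ^ 2 ^ 2) set" where
  "tangent D r m = {X. \<exists>g\<in>D. mcong (r + m) g (mat 1 + scale (2 ^ r) X)}"

lemma open_submodule_tangent:
  assumes D: "subgroup D GL2" and "m \<le> r"
  shows "open_submodule m (tangent D r m)"
proof -
  let ?T = "tangent D r m"
  have zero: "0 \<in> ?T"
  proof -
    have "mat 1 + scale (2 ^ r) 0 = (mat 1 :: padic2 ^ 2 ^ 2)"
      by (simp add: mat2_simps)
    then show ?thesis
      using subgroup.one_closed[OF D] by (auto simp: tangent_def intro: bexI[of _ "mat 1"])
  qed
  have add: "X + Y \<in> ?T" if X: "X \<in> ?T" and Y: "Y \<in> ?T" for X Y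
  proof -
    obtain g h where g: "g \<in> D" "mcong (r + m) g (mat 1 + scale (2 ^ r) X)"
      and h: "h \<in> D" "mcong (r + m) h (mat 1 + scale (2 ^ r) Y)"
      using X Y by (auto simp: tangent_def)
    have "(mat 1 + scale (2 ^ r) X) ** (mat 1 + scale (2 ^ r) Y) =
        (mat 1 + scale (2 ^ r) (X + Y)) + scale (2 ^ (r + r)) (X ** Y)"
      by (simp add: mat2_simps power_add algebra_simps)
    then have "mcong (r + r) ((mat 1 + scale (2 ^ r) X) ** (mat 1 + scale (2 ^ r) Y))
        (mat 1 + scale (2 ^ r) (X + Y))"
      unfolding mcong_iff by blast
    then have "mcong (r + m) ((mat 1 + scale (2 ^ r) X) ** (mat 1 + scale (2 ^ r) Y))
        (mat 1 + scale (2 ^ r) (X + Y))"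
      by (rule mcong_mono) (use \<open>m \<le> r\<close> in simp)
    then have "mcong (r + m) (g ** h) (mat 1 + scale (2 ^ r) (X + Y))"
      using mcong_mult[OF g(2) h(2)] mcong_trans by blast
    moreover have "g ** h \<in> D"
      using subgroup.m_closed[OF D g(1) h(1)] by simp
    ultimately show ?thesis
      by (auto simp: tangent_def)
  qed
  have invariant: "Y \<in> ?T" if X: "X \<in> ?T" and "mcong m X Y" for X Y
  proof -
    obtain g where g: "g \<in> D" "mcong (r + m) g (mat 1 + scale (2 ^ r) X)"
      using X by (auto simp: tangent_def)
    have "mcong (r + m) (mat 1 + scale (2 ^ r) X) (mat 1 + scale (2 ^ r) Y)"
      using \<open>mcong m X Y\<close> by (intro mcong_add mcong_scale_power mcong_refl)
    then show ?thesis
      using g mcong_trans unfolding tangent_def by blast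
  qed
  \<comment> \<open>Addition gives multiples by natural numbers. A 2-adic scalar agrees with such a
    number modulo \<open>2 ^ m\<close>, and \<open>invariant\<close> absorbs the difference.\<close>
  have "scale c X \<in> ?T" if X: "X \<in> ?T" for c X
  proof -
    have "scale (of_nat k) X \<in> ?T" for k
    proof (induction k)
      case 0
      have "scale 0 X = 0" by (simp add: mat2_simps)
      then show ?case using zero by (simp only: of_nat_0)
    next
      case (Suc k)
      have "scale (of_nat (Suc k)) X = X + scale (of_nat k) X"
        by (simp add: mat2_simps algebra_simps)
      then show ?case using add[OF X Suc] by simp
    qed
    moreover have "of_nat (nat (residue c m)) = (of_int (residue c m) :: padic2)"
      using residue_range[of c m] by simp
    moreover have "mcong m (scale (of_int (residue c m)) X) (scale c X)"
    proof -
      have "mcong m (scale c X) (scale (of_int (residue c m)) X)"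
        unfolding mcong_def using dvd_mult2[OF dvd_diff_residue[of m c]]
        by (simp add: left_diff_distrib)
      then show ?thesis by (rule mcong_sym)
    qed
    ultimately show ?thesis
      using invariant by metis
  qed
  then show ?thesis
    using zero add invariant unfolding open_submodule_def by blast
qed

section \<open>Powers and their commutators\<close>

text \<open>By Cayley-Hamilton, a trace-zero \<open>x\<close> has the scalar square
  \<open>- det x\<close>.\<close>

lemma trace_zero_square:
  fixes x :: "'a::comm_ring_1 ^ 2 ^ 2"
  assumes "trace x = 0"
  shows "(mat s + scale c x) ** (mat s + scale c x) = mat (s * s - c * c * det x) + scale (2 * s * c) x"
proof -
  have "x$2$2 = - x$1$1"
    using assms by (simp add: trace_2 eq_neg_iff_add_eq_0 add.commute)
  then show ?thesis
    by (simp add: mat2_simps algebra_simps)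
qed

text \<open>Each squaring doubles the coefficient of \<open>x\<close> up to the odd factor
  \<open>s\<close>. The new scalar part stays odd, even at the first squaring, because even entries
  make \<open>det x\<close> even.\<close>

lemma iterated_square:
  fixes x :: "padic2 ^ 2 ^ 2"
  assumes G: "subgroup G GL2" and g: "mat t + x \<in> G"
    and x: "trace x = 0" "\<And>i j. 2 dvd x $ i $ j" and "\<not> 2 dvd t"
  shows "\<exists>s u. \<not> 2 dvd s \<and> \<not> 2 dvd u \<and> mat s + scale (2 ^ a * u) x \<in> G"
proof (induction a)
  case 0
  have "mat t + scale (2 ^ 0 * 1) x = mat t + x"
    by (simp add: mat2_simps)
  then show ?case
    using g \<open>\<not> 2 dvd t\<close> two_not_dvd_one by metis
next
  case (Suc a)
  then obtain s u where su: "\<not> 2 dvd s" "\<not> 2 dvd u" and h: "mat s + scale (2 ^ a * u) x \<in> G"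
    by blast
  let ?c = "2 ^ a * u"
  have "mat (s * s - ?c * ?c * det x) + scale (2 ^ Suc a * (s * u)) x \<in> G"
    using subgroup.m_closed[OF G h h] trace_zero_square[OF x(1), of s ?c]
    by (simp add: algebra_simps)
  moreover have "2 dvd det x"
    unfolding det_2 using x(2) by (intro dvd_diff dvd_mult)
  then have "\<not> 2 dvd s * s - ?c * ?c * det x"
    using odd_times[OF su(1) su(1)] by (simp add: dvd_diff_left_iff)
  moreover have "\<not> 2 dvd s * u"
    using su by (rule odd_times)
  ultimately show ?case by blast
qed

lemma commutator_in_derived:
  assumes "G \<subseteq> carrier GL2" "h1 \<in> G" "h2 \<in> G"
  shows "h1 ** h2 ** inv\<^bsub>GL2\<^esub> h1 ** inv\<^bsub>GL2\<^esub> h2 \<in> derived GL2 G"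
  using assms unfolding derived_def by (intro generate.incl) auto

text \<open>With \<open>w\<close> the inverse of \<open>h2 ** h1\<close>, the commutator is
  \<open>1 + (h1 ** h2 - h2 ** h1) ** w\<close>. Scalars commute with everything, so the difference
  is exactly \<open>2 ^ (2 * a) * u1 * u2\<close> times the bracket of \<open>x\<close> and
  \<open>y\<close>.\<close>

lemma bracket_in_tangent:
  assumes G: "subgroup G GL2"
    and h1: "mat s1 + scale (2 ^ a * u1) x \<in> G" and h2: "mat s2 + scale (2 ^ a * u2) y \<in> G"
    and odd: "\<not> 2 dvd s1" "\<not> 2 dvd s2" "\<not> 2 dvd u1" "\<not> 2 dvd u2"
  shows "bracket x y \<in> tangent (derived GL2 G) (2 * a) a"
proof -
  let ?h1 = "mat s1 + scale (2 ^ a * u1) x" and ?h2 = "mat s2 + scale (2 ^ a * u2) y"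
  define w where "w = inv\<^bsub>GL2\<^esub> ?h1 ** inv\<^bsub>GL2\<^esub> ?h2"
  note carrier = subgroup.mem_carrier[OF G h1] subgroup.mem_carrier[OF G h2]
  have w: "?h2 ** ?h1 ** w = mat 1"
  proof -
    have "?h2 ** ?h1 ** w = ?h2 ** (?h1 ** inv\<^bsub>GL2\<^esub> ?h1) ** inv\<^bsub>GL2\<^esub> ?h2"
      by (simp only: w_def matrix_mul_assoc)
    then show ?thesis
      by (simp only: inv_GL2(1)[OF carrier(1)] inv_GL2(1)[OF carrier(2)] matrix_mul_rid)
  qed
  obtain r where r: "s1 * s2 * r = 1"
    using odd_times[OF odd(1,2)] odd_inverse by blast
  \<comment> \<open>Since the difference already carries \<open>2 ^ (2 * a)\<close>, it suffices to
    know \<open>w\<close> modulo \<open>2 ^ a\<close>, where it is the scalar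
    \<open>r\<close>.\<close>
  have "?h2 ** ?h1 = mat (s1 * s2) + scale (2 ^ a)
      (scale (u1 * s2) x + scale (u2 * s1) y + scale (2 ^ a * u1 * u2) (y ** x))"
    by (simp add: mat2_simps algebra_simps)
  then have "mcong a (?h2 ** ?h1) (mat (s1 * s2))"
    unfolding mcong_iff by blast
  then have "mcong a (mat 1) (mat (s1 * s2) ** w)"
    using mcong_mult[of a _ _ w w] w by (metis mcong_refl)
  then have "mcong a (scale r (mat 1)) (scale r (mat (s1 * s2) ** w))"
    by (rule mcong_scale)
  moreover have "scale r (mat (s1 * s2) ** w) = scale (s1 * s2 * r) w"
    by (simp add: mat2_simps algebra_simps)
  then have "scale r (mat (s1 * s2) ** w) = w"
    unfolding r by (simp add: mat2_simps)
  ultimately have "mcong a w (scale r (mat 1))"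
    by (metis mcong_sym)
  then have "mcong a (scale (u1 * u2) (bracket x y ** w)) (scale (u1 * u2) (bracket x y ** scale r (mat 1)))"
    by (intro mcong_scale mcong_mult mcong_refl)
  moreover have "scale (u1 * u2) (bracket x y ** scale r (mat 1)) = scale (u1 * u2 * r) (bracket x y)"
    by (simp add: mat2_simps algebra_simps)
  ultimately have "mcong (2 * a + a) (mat 1 + scale (2 ^ (2 * a)) (scale (u1 * u2) (bracket x y ** w)))
      (mat 1 + scale (2 ^ (2 * a)) (scale (u1 * u2 * r) (bracket x y)))"
    by (intro mcong_add mcong_refl mcong_scale_power) simp
  moreover have "?h1 ** ?h2 = ?h2 ** ?h1 + scale (2 ^ (2 * a)) (scale (u1 * u2) (bracket x y))"
    unfolding mult_2[of a] power_add by (simp add: bracket_def mat2_simps algebra_simps)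
  then have "?h1 ** ?h2 ** w = mat 1 + scale (2 ^ (2 * a)) (scale (u1 * u2) (bracket x y)) ** w"
    using w by (simp add: matrix_add_rdistrib_2)
  then have "?h1 ** ?h2 ** w = mat 1 + scale (2 ^ (2 * a)) (scale (u1 * u2) (bracket x y ** w))"
    by (simp add: mat2_simps algebra_simps)
  moreover have "?h1 ** ?h2 ** w \<in> derived GL2 G"
    using commutator_in_derived[OF subgroup.subset[OF G] h1 h2] by (simp add: w_def matrix_mul_assoc)
  ultimately have "scale (u1 * u2 * r) (bracket x y) \<in> tangent (derived GL2 G) (2 * a) a"
    unfolding tangent_def by auto
  \<comment> \<open>The tangent set is closed under all scalars, so the odd factor
    \<open>u1 * u2 * r\<close> is cancelled by its inverse \<open>s1 * s2 * v\<close>.\<close>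
  moreover obtain v where v: "u1 * u2 * v = 1"
    using odd_times[OF odd(3,4)] odd_inverse by blast
  have "scale (s1 * s2 * v) (scale (u1 * u2 * r) (bracket x y)) = scale ((s1 * s2 * r) * (u1 * u2 * v)) (bracket x y)"
    by (simp add: mat2_simps algebra_simps)
  then have "scale (s1 * s2 * v) (scale (u1 * u2 * r) (bracket x y)) = bracket x y"
    unfolding r v by (simp add: mat2_simps)
  moreover have "open_submodule a (tangent (derived GL2 G) (2 * a) a)"
    using group.derived_is_subgroup[OF group_GL2 subgroup.subset[OF G]]
    by (rule open_submodule_tangent) simp
  ultimately show ?thesis
    unfolding open_submodule_def by metis
qed

section \<open>Density by successive approximation\<close>

lemma det_derived:
  fixes G :: "('a::comm_ring_1 ^ 2 ^ 2) set"
  assumes "G \<subseteq> carrier GL2" "g \<in> derived GL2 G"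
  shows "det g = 1"
proof -
  interpret group "GL2 :: ('a ^ 2 ^ 2) monoid" by (rule group_GL2)
  let ?S = "{A :: 'a ^ 2 ^ 2. det A = 1}"
  have "subgroup ?S GL2"
  proof (rule subgroupI)
    show "inv\<^bsub>GL2\<^esub> A \<in> ?S" if "A \<in> ?S" for A
      using det_inv_GL2[of A] that det_one_in_GL2[of A] by simp
    have "mat 1 \<in> ?S" by simp
    then show "?S \<noteq> {}" by blast
  qed (auto simp: det_mul det_one_in_GL2)
  moreover have "derived_set GL2 G \<subseteq> ?S"
  proof clarify
    fix h k assume "h \<in> G" "k \<in> G"
    then have "h \<in> carrier GL2" "k \<in> carrier GL2"
      using assms by auto
    then have "(det h * det (inv\<^bsub>GL2\<^esub> h)) * (det k * det (inv\<^bsub>GL2\<^esub> k)) = 1"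
      by (simp add: det_inv_GL2)
    then show "det (h \<otimes>\<^bsub>GL2\<^esub> k \<otimes>\<^bsub>GL2\<^esub> inv\<^bsub>GL2\<^esub> h \<otimes>\<^bsub>GL2\<^esub> inv\<^bsub>GL2\<^esub> k) = 1"
      by (simp add: det_mul algebra_simps)
  qed
  ultimately have "derived GL2 G \<subseteq> ?S"
    unfolding derived_def by (intro generate_subgroup_incl)
  then show ?thesis
    using assms(2) by blast
qed

text \<open>For \<open>g = 1 + 2 ^ j * C\<close>, expanding \<open>det g = 1\<close> shows that
  \<open>2 ^ j * trace C\<close> is divisible by \<open>2 ^ (2 * j)\<close>, hence by
  \<open>2 ^ Suc j\<close>. Changing the last diagonal entry of \<open>C\<close> then makes the
  trace exactly zero.\<close>

lemma B2_first_order: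
  assumes "g \<in> B2 j" "j > 0"
  shows "\<exists>X. trace X = 0 \<and> mcong (Suc j) g (mat 1 + scale (2 ^ j) X)"
proof -
  obtain C where C: "g = mat 1 + scale (2 ^ j) C"
    using assms(1) unfolding B2_iff mcong_iff by blast
  define X where "X = mat2 (C$1$1) (C$1$2) (C$2$1) (- C$1$1)"
  have "det g = 1"
    using assms(1) by (simp add: B2_iff)
  then have "2 ^ j * (C$1$1 + C$2$2) = 2 ^ (j + j) * (C$1$2 * C$2$1 - C$1$1 * C$2$2)"
    unfolding C by (simp add: mat2_simps power_add algebra_simps)
  moreover have "2 ^ Suc j dvd (2 :: padic2) ^ (j + j)"
    using assms(2) by (intro le_imp_power_dvd) simp
  ultimately have "2 ^ Suc j dvd 2 ^ j * (C$1$1 + C$2$2)"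
    by (metis dvd_mult2)
  then have "mcong (Suc j) g (mat 1 + scale (2 ^ j) X)"
    unfolding mcong_def all_2_matrix by (simp add: C X_def mat_nth algebra_simps)
  moreover have "trace X = 0"
    by (simp add: X_def trace_2)
  ultimately show ?thesis by blast
qed

text \<open>The square of \<open>1 + 2 ^ j * Y\<close> is
  \<open>1 + 2 ^ Suc j * Y + 2 ^ (2 * j) * (Y ** Y)\<close>, and \<open>2 * j \<ge> j + 2\<close>
  removes the last term modulo \<open>2 ^ (j + 2)\<close>.\<close>

lemma square_approx:
  assumes D: "subgroup D GL2" and "j \<ge> 2"
    and "\<exists>g\<in>D. mcong (Suc j) g (mat 1 + scale (2 ^ j) X)"
  shows "\<exists>g\<in>D. mcong (Suc (Suc j)) g (mat 1 + scale (2 ^ Suc j) X)"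
proof -
  obtain g where g: "g \<in> D" "mcong (Suc j) g (mat 1 + scale (2 ^ j) X)"
    using assms(3) by blast
  then obtain C where C: "g = mat 1 + scale (2 ^ j) X + scale (2 ^ Suc j) C"
    unfolding mcong_iff by blast
  define Y where "Y = X + scale 2 C"
  have "g = mat 1 + scale (2 ^ j) Y"
    unfolding C Y_def by (simp add: mat2_simps algebra_simps)
  moreover obtain k where "j = Suc (Suc k)"
    using \<open>j \<ge> 2\<close> by (metis add_2_eq_Suc le_Suc_ex)
  ultimately have "g ** g = (mat 1 + scale (2 ^ Suc j) X) +
      scale (2 ^ Suc (Suc j)) (C + scale (2 ^ k) (Y ** Y))"
    unfolding Y_def by (simp add: mat2_simps algebra_simps)
  then have "mcong (Suc (Suc j)) (g ** g) (mat 1 + scale (2 ^ Suc j) X)"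
    unfolding mcong_iff by blast
  moreover have "g ** g \<in> D"
    using subgroup.m_closed[OF D g(1) g(1)] by simp
  ultimately show ?thesis by blast
qed

text \<open>If \<open>h\<close> agrees with \<open>g\<close> modulo \<open>2 ^ j\<close>, the
  quotient \<open>d\<close> lies in \<open>B2 j\<close>, and an element of \<open>D\<close> with the
  same first-order term as \<open>d\<close> improves \<open>h\<close> by one power of 2.\<close>

lemma B2_approx:
  assumes D: "subgroup D GL2" and det: "\<And>g. g \<in> D \<Longrightarrow> det g = 1" and "k \<ge> 2"
    and first: "\<And>X. trace X = 0 \<Longrightarrow> \<exists>g\<in>D. mcong (Suc k) g (mat 1 + scale (2 ^ k) X)"
    and g: "g \<in> B2 k"
  shows "\<exists>h\<in>D. mcong m h g"
proof -
  have approx: "\<exists>h\<in>D. mcong (Suc j) h (mat 1 + scale (2 ^ j) X)" if "j \<ge> k" "trace X = 0" for j X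
    using that(1)
  proof (induction j rule: dec_induct)
    case base
    show ?case using first that(2) by blast
  next
    case (step j)
    then show ?case
      using \<open>k \<ge> 2\<close> by (intro square_approx D) auto
  qed
  have "\<exists>h\<in>D. mcong j h g" if "j \<ge> k" for j
    using that
  proof (induction j rule: dec_induct)
    case base
    have "mat 1 \<in> D"
      using subgroup.one_closed[OF D] by simp
    moreover have "mcong k (mat 1) g"
      using g by (simp add: B2_iff mcong_sym)
    ultimately show ?case by blast
  next
    case (step j)
    then obtain h where h: "h \<in> D" "mcong j h g"
      by blast
    have carrier: "h \<in> carrier GL2"
      using subgroup.mem_carrier[OF D h(1)] .
    define d where "d = inv\<^bsub>GL2\<^esub> h ** g"
    have "det d = 1"
      using det_inv_GL2[OF carrier] det[OF h(1)] g by (simp add: d_def det_mul B2_iff)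
    moreover have "mcong j (inv\<^bsub>GL2\<^esub> h ** g) (inv\<^bsub>GL2\<^esub> h ** h)"
      by (rule mcong_mult[OF mcong_refl mcong_sym[OF h(2)]])
    ultimately have "d \<in> B2 j"
      by (simp add: B2_iff d_def inv_GL2(2)[OF carrier])
    then obtain X where X: "trace X = 0" "mcong (Suc j) d (mat 1 + scale (2 ^ j) X)"
      using B2_first_order[of d j] step.hyps \<open>k \<ge> 2\<close> by auto
    obtain h' where h': "h' \<in> D" "mcong (Suc j) h' (mat 1 + scale (2 ^ j) X)"
      using approx[OF step.hyps(1) X(1)] by blast
    have "mcong (Suc j) h' d"
      using h'(2) mcong_sym[OF X(2)] by (rule mcong_trans)
    then have "mcong (Suc j) (h ** h') (h ** d)"
      by (intro mcong_mult mcong_refl)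
    moreover have "h ** d = g"
      by (simp only: d_def matrix_mul_assoc inv_GL2(1)[OF carrier] matrix_mul_lid)
    moreover have "h ** h' \<in> D"
      using subgroup.m_closed[OF D h(1) h'(1)] by simp
    ultimately show ?case by metis
  qed
  \<comment> \<open>The induction only reaches exponents from \<open>k\<close> on; a smaller
    \<open>m\<close> is covered by monotonicity.\<close>
  from this[of "max k m"] show ?thesis
    using mcong_mono max.cobounded1 max.cobounded2 by metis
qed

section \<open>Elementary matrices\<close>

lemma mat2_mult:
  "mat2 a b c d ** mat2 a' b' c' d' =
    (mat2 (a * a' + b * c') (a * b' + b * d') (c * a' + d * c') (c * b' + d * d')
      :: 'a::comm_ring_1 ^ 2 ^ 2)"
  by (simp add: mat2_simps)

text \<open>Conjugation by the diagonal matrix with entries \<open>u\<close> and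
  \<open>1 / u\<close> multiplies an upper elementary parameter by \<open>u * u\<close>, so the
  commutator has parameter \<open>(u * u - 1) * b'\<close>. For \<open>u = 1 + 2 ^ k\<close> with
  \<open>k \<ge> 2\<close> that factor is \<open>2 ^ (k + 1)\<close> times a unit.\<close>

lemma elementary_in_derived:
  assumes sub: "G \<subseteq> carrier GL2" and G: "B2 k \<subseteq> G" and "k \<ge> 2" and b: "2 ^ (2 * k + 1) dvd b"
  shows "mat2 1 b 0 1 \<in> derived GL2 G" "mat2 1 0 b 1 \<in> derived GL2 G"
proof -
  define u :: padic2 where "u = 1 + 2 ^ k"
  obtain v where uv: "u * v = 1"
    using odd_inverse[OF odd_one_plus[of k "2 ^ k"]] \<open>k \<ge> 2\<close> unfolding u_def by auto
  have "1 \<le> k - 1"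
    using \<open>k \<ge> 2\<close> by simp
  then obtain w where w: "(1 + 2 ^ (k - 1)) * w = (1 :: padic2)"
    using odd_inverse[OF odd_one_plus[OF _ dvd_refl]] by blast
  obtain c where c: "b = 2 ^ (2 * k + 1) * c"
    using b by (elim dvdE)
  \<comment> \<open>This is \<open>b\<close> divided by \<open>u * u - 1\<close>; the exponent
    \<open>2 * k + 1\<close> leaves it divisible by \<open>2 ^ k\<close>.\<close>
  define b' where "b' = 2 ^ k * (c * w)"
  have "u * u - 1 = 2 ^ (k + 1) * (1 + 2 ^ (k - 1))"
  proof -
    obtain l where "k = Suc l" using \<open>k \<ge> 2\<close> by (cases k) auto
    then show ?thesis by (simp add: u_def algebra_simps)
  qed
  then have "(u * u - 1) * b' = 2 ^ (k + 1) * 2 ^ k * c * ((1 + 2 ^ (k - 1)) * w)"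
    by (simp only: b'_def ac_simps)
  moreover have "(2 :: padic2) ^ (2 * k + 1) = 2 ^ (k + 1) * 2 ^ k"
    unfolding mult_2[of k] power_add by (simp add: ac_simps)
  ultimately have b': "u * u * b' - b' = b"
    by (simp only: w c left_diff_distrib mult_1_left mult_1_right)
  have vu: "v * u = 1"
    using uv by (simp add: mult.commute)
  have u_minus_1: "u - 1 = 2 ^ k"
    by (simp add: u_def)
  have "v - 1 = - (2 ^ k * v)"
    using uv unfolding u_def by (simp add: algebra_simps)
  then have "2 ^ k dvd v - 1"
    by (metis dvd_minus_iff dvd_triv_left)
  then have "mat2 u 0 0 v \<in> B2 k" "mat2 v 0 0 u \<in> B2 k" "mat2 1 b' 0 1 \<in> B2 k" "mat2 1 0 b' 1 \<in> B2 k"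
    using uv vu by (auto intro!: mat2_in_B2 simp: b'_def u_minus_1)
  then have in_G: "mat2 u 0 0 v \<in> G" "mat2 v 0 0 u \<in> G" "mat2 1 b' 0 1 \<in> G" "mat2 1 0 b' 1 \<in> G"
    using G by blast+
  have "mat2 u 0 0 v ** mat2 1 b' 0 1 ** inv\<^bsub>GL2\<^esub> (mat2 u 0 0 v) ** inv\<^bsub>GL2\<^esub> (mat2 1 b' 0 1)
      = mat2 1 (u * u * b' - b') 0 1"
    using uv vu by (simp add: inv_GL2_eq_mat2 mat2_mult ac_simps)
  then show "mat2 1 b 0 1 \<in> derived GL2 G"
    using commutator_in_derived[OF sub in_G(1) in_G(3)] by (simp add: b')
  \<comment> \<open>The diagonal entries are swapped so that the lower left parameter is again
    multiplied by \<open>u * u\<close>.\<close>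
  have "mat2 v 0 0 u ** mat2 1 0 b' 1 ** inv\<^bsub>GL2\<^esub> (mat2 v 0 0 u) ** inv\<^bsub>GL2\<^esub> (mat2 1 0 b' 1)
      = mat2 1 0 (u * u * b' - b') 1"
    using uv vu by (simp add: inv_GL2_eq_mat2 mat2_mult ac_simps)
  then show "mat2 1 0 b 1 \<in> derived GL2 G"
    using commutator_in_derived[OF sub in_G(2) in_G(4)] by (simp add: b')
qed

lemma B2_subset_if_elementary:
  assumes D: "subgroup D GL2" and "m > 0"
    and upper: "\<And>b. 2 ^ m dvd b \<Longrightarrow> mat2 1 b 0 1 \<in> D"
    and lower: "\<And>b. 2 ^ m dvd b \<Longrightarrow> mat2 1 0 b 1 \<in> D"
  shows "B2 (2 * m) \<subseteq> D"
proof
  fix g assume g: "g \<in> B2 (2 * m)"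
  define a b c d where "a = g$1$1" and "b = g$1$2" and "c = g$2$1" and "d = g$2$2"
  have "mcong m g (mat 1)"
    using g mcong_mono[of "2 * m" g "mat 1" m] by (simp add: B2_iff)
  then have dvd: "2 ^ m dvd b" "2 ^ m dvd c"
    unfolding mcong_def all_2_matrix by (simp_all add: mat_nth b_def c_def)
  have "2 ^ (2 * m) dvd a - 1"
    using g by (simp add: B2_iff mcong_def all_2_matrix mat_nth a_def)
  then obtain s where "a - 1 = 2 ^ (2 * m) * s"
    by (elim dvdE)
  \<comment> \<open>The exponent \<open>2 * m\<close> lets \<open>a - 1\<close> split into two
    factors divisible by \<open>2 ^ m\<close>, the elementary parameters \<open>x\<close> and
    \<open>y\<close>.\<close>
  then have s: "a = 1 + 2 ^ m * (2 ^ m * s)"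
    unfolding mult_2[of m] power_add by (simp add: algebra_simps)
  \<comment> \<open>The product of an upper and a lower elementary matrix with parameters \<open>x\<close> and \<open>y\<close> has upper left
    entry \<open>a\<close>, after which one row and one column operation turn it into \<open>g\<close>.\<close>
  obtain v where v: "a * v = 1"
    using odd_inverse odd_one_plus[of m "2 ^ m * (2 ^ m * s)"] \<open>m > 0\<close> s by auto
  define x y where "x = (2 ^ m :: padic2)" and "y = 2 ^ m * s"
  have a: "a = 1 + x * y"
    using s by (simp add: x_def y_def)
  have det: "a * d - b * c = 1"
    using g by (simp add: B2_iff det_2 a_def b_def c_def d_def)
  have 1: "((c - y) * v) * a + y = c" "a * ((b - x) * v) + x = b"
  proof -
    have "((c - y) * v) * a + y = (c - y) * (a * v) + y" "a * ((b - x) * v) + x = (b - x) * (a * v) + x"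
      by (simp_all add: ac_simps)
    then show "((c - y) * v) * a + y = c" "a * ((b - x) * v) + x = b"
      by (simp_all add: v)
  qed
  \<comment> \<open>The lower right entry of the product equals \<open>d\<close> because
    \<open>det g = 1\<close> and \<open>a\<close> is a unit.\<close>
  have "((c - y) * v * x + 1) + c * ((b - x) * v) = v * (b * c - x * y) + 1"
    by (simp add: algebra_simps)
  also have "\<dots> = v * (b * c + 1) - a * v + 1"
    unfolding a by (simp add: algebra_simps)
  also have "b * c + 1 = a * d"
    using det by (simp add: algebra_simps)
  also have "v * (a * d) - a * v + 1 = a * v * d - a * v + 1"
    by (simp add: ac_simps)
  finally have 2: "c * ((b - x) * v) + ((c - y) * v * x + 1) = d"
    by (simp add: v add.commute)
  have "mat2 1 x 0 1 ** mat2 1 0 y 1 = mat2 a x y 1"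
    by (simp add: mat2_mult a)
  moreover have "mat2 1 0 ((c - y) * v) 1 ** mat2 a x y 1 = mat2 a x c ((c - y) * v * x + 1)"
    using 1 by (simp add: mat2_mult)
  moreover have "mat2 a x c ((c - y) * v * x + 1) ** mat2 1 ((b - x) * v) 0 1 = mat2 a b c d"
    using 1 2 by (simp add: mat2_mult)
  moreover have "g = mat2 a b c d"
    by (simp add: matrix_2_eq_iff a_def b_def c_def d_def)
  ultimately have "g = mat2 1 0 ((c - y) * v) 1 ** (mat2 1 x 0 1 ** mat2 1 0 y 1) ** mat2 1 ((b - x) * v) 0 1"
    by simp
  moreover have "mat2 1 0 ((c - y) * v) 1 \<in> D" "mat2 1 x 0 1 \<in> D" "mat2 1 0 y 1 \<in> D"
    "mat2 1 ((b - x) * v) 0 1 \<in> D"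
    using dvd by (auto intro!: upper lower dvd_mult2 dvd_diff simp: x_def y_def)
  ultimately show "g \<in> D"
    using subgroup.m_closed[OF D] by (metis mult_GL2)
qed

lemma B2_subset_derived:
  assumes G: "closed_subgroup GL2 G" and "k \<ge> 2"
    and first: "\<And>X. trace X = 0 \<Longrightarrow> \<exists>g\<in>derived GL2 G. mcong (Suc k) g (mat 1 + scale (2 ^ k) X)"
  shows "B2 k \<subseteq> derived GL2 G"
proof -
  let ?D = "derived GL2 G"
  have sub: "subgroup G GL2" and closed: "closedin (top_of_set (carrier GL2)) G"
    using G by (auto simp: closed_subgroup_def)
  have carrier: "G \<subseteq> carrier GL2"
    using subgroup.subset[OF sub] .
  have D: "subgroup ?D GL2"
    using group.derived_is_subgroup[OF group_GL2 carrier] .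
  have "?D \<subseteq> G"
    using group.derived_incl[OF group_GL2 _ sub] by blast
  have approx: "\<exists>h\<in>?D. mcong m h g" if "g \<in> B2 k" for g m
    using D det_derived[OF carrier] \<open>k \<ge> 2\<close> first that by (rule B2_approx)
  \<comment> \<open>\<open>?D\<close> approximates every element of \<open>B2 k\<close> and is
    contained in \<open>G\<close>, which is closed in GL2.\<close>
  have "B2 k \<subseteq> G"
  proof
    fix g assume g: "g \<in> B2 k"
    then have "g \<in> carrier GL2"
      by (simp add: B2_iff det_one_in_GL2)
    then show "g \<in> G"
      using approx[OF g] \<open>?D \<subseteq> G\<close> by (intro closedin_approx[OF closed]) blast+
  qed
  then have large: "B2 (2 * (2 * k + 1)) \<subseteq> ?D"
    using elementary_in_derived[OF carrier _ \<open>k \<ge> 2\<close>] by (intro B2_subset_if_elementary D) auto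
  \<comment> \<open>\<open>large\<close> puts the error of a sufficiently fine approximation into
    \<open>?D\<close>, so no limit has to be taken there.\<close>
  show ?thesis
  proof
    fix g assume g: "g \<in> B2 k"
    obtain h where h: "h \<in> ?D" "mcong (2 * (2 * k + 1)) h g"
      using approx[OF g] by blast
    have hG: "h \<in> carrier GL2"
      using subgroup.mem_carrier[OF D h(1)] .
    have "mcong (2 * (2 * k + 1)) (inv\<^bsub>GL2\<^esub> h ** g) (inv\<^bsub>GL2\<^esub> h ** h)"
      by (rule mcong_mult[OF mcong_refl mcong_sym[OF h(2)]])
    moreover have "det (inv\<^bsub>GL2\<^esub> h) = 1"
      using det_derived[OF carrier subgroup.m_inv_closed[OF D h(1)]] .
    ultimately have "inv\<^bsub>GL2\<^esub> h ** g \<in> B2 (2 * (2 * k + 1))"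
      using g by (simp add: B2_iff det_mul inv_GL2(2)[OF hG])
    then have "h ** (inv\<^bsub>GL2\<^esub> h ** g) \<in> ?D"
      using large subgroup.m_closed[OF D h(1)] by auto
    then show "g \<in> ?D"
      by (simp add: matrix_mul_assoc inv_GL2(1)[OF hG])
  qed
qed

section \<open>The congruence conditions\<close>

lemma mod4_eq_iff: "mod4 x = mod4 y \<longleftrightarrow> 2 ^ 2 dvd x - y"
  using residue_mod_self[of x 2] residue_mod_self[of y 2]
  by (simp add: mod4_def of_int_eq_iff_cong_CHAR cong_def power2_dvd_diff_iff[of 2 x y, simplified])

lemma mod8_eq_iff: "mod8 x = mod8 y \<longleftrightarrow> 2 ^ 3 dvd x - y"
  using residue_mod_self[of x 3] residue_mod_self[of y 3]
  by (simp add: mod8_def of_int_eq_iff_cong_CHAR cong_def power2_dvd_diff_iff[of 3 x y, simplified])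

lemma of_int_mod8: "of_int (z mod 8) = (of_int z :: 8)"
  by (simp add: of_int_eq_iff_cong_CHAR)

lemma mod4_0_1: "mod4 0 = 0" "mod4 1 = 1"
  and mod8_1: "mod8 1 = 1"
  by (simp_all add: mod4_def mod8_def residue_one)

lemma mod8_mult: "mod8 (x * y) = mod8 x * mod8 y"
  and mod8_diff: "mod8 (x - y) = mod8 x - mod8 y"
  by (simp_all add: mod8_def residue_mult residue_diff of_int_mod8)

lemma det_map_mod8: "det (map_matrix mod8 A) = mod8 (det (A :: padic2 ^ 2 ^ 2))"
  by (simp add: det_2 mod8_mult mod8_diff)

lemma map_mod4_eq_one_iff: "map_matrix mod4 A = mat 1 \<longleftrightarrow> mcong 2 A (mat 1)"
proof -
  have "map_matrix mod4 A = mat 1 \<longleftrightarrow> map_matrix mod4 A = map_matrix mod4 (mat 1)"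
    by (simp add: matrix_2_eq_iff mat_nth mod4_0_1)
  also have "\<dots> \<longleftrightarrow> mcong 2 A (mat 1)"
    unfolding mcong_def all_2_matrix by (simp add: matrix_2_eq_iff mod4_eq_iff)
  finally show ?thesis .
qed

text \<open>Nonemptiness appears because the reduced image has to equal a singleton.\<close>

lemma congruence_conditions_iff:
  "congruence_conditions G \<longleftrightarrow> G \<noteq> {} \<and> (\<forall>g\<in>G. mcong 2 g (mat 1) \<and> 2 ^ 3 dvd det g - 1)"
  unfolding congruence_conditions_def map_mod4_eq_one_iff[symmetric] by auto

lemma congruence_kernel_eq:
  "congruence_kernel G = {g \<in> G. mcong 2 g (mat 1) \<and> 2 ^ 3 dvd det g - 1}"
proof -
  have "congruence_kernel G = {g \<in> G. map_matrix mod4 g = mat 1 \<and> mod8 (det g) = mod8 1}"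
    by (auto simp: congruence_kernel_def kernel_def unit_group_def det_map_mod8 mod8_1)
  then show ?thesis
    by (simp only: map_mod4_eq_one_iff mod8_eq_iff)
qed

section \<open>From the congruence conditions to the derived subgroup\<close>

lemma Theta_decomposition:
  assumes "mcong 2 g (mat 1)"
  shows "\<exists>t. \<not> 2 dvd t \<and> mat t + Theta g = g" "trace (Theta g) = 0" "2 dvd Theta g $ i $ j"
proof -
  obtain C where C: "g = mat 1 + scale (2 ^ 2) C"
    using assms unfolding mcong_iff by blast
  \<comment> \<open>This is half the trace of \<open>g\<close>, and it is odd. Subtracting it leaves
    \<open>scale (2 ^ 2) C\<close> minus the scalar \<open>2 * trace C\<close>, which is
    even.\<close>
  define t where "t = 1 + 2 * trace C"
  have "trace g = 2 * t"
    by (simp add: C t_def trace_2 mat_nth algebra_simps)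
  then have Theta: "Theta g = g - mat t"
    by (simp add: Theta_def)
  have "\<not> 2 dvd t"
    using odd_one_plus[of 1 "2 * trace C"] by (simp add: t_def)
  moreover have "mat t + Theta g = g"
    by (simp add: Theta)
  ultimately show "\<exists>t. \<not> 2 dvd t \<and> mat t + Theta g = g" by blast
  show "trace (Theta g) = 0"
    using \<open>trace g = 2 * t\<close> by (simp add: Theta trace_2 mat_nth algebra_simps)
  have "Theta g = scale 2 (scale 2 C - mat (trace C))"
    unfolding Theta by (simp add: C t_def matrix_2_eq_iff mat_nth)
  then show "2 dvd Theta g $ i $ j"
    by (simp only: nth_map_matrix dvd_triv_left)
qed

lemma derived_contains_B2:
  assumes closed: "closed_subgroup GL2 G" and cong: "congruence_conditions G" and "n > 0"
    and L: "scale (2 ^ n) ` carrier sl2 \<subseteq> L G"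
  shows "B2 (12 * n + 2) \<subseteq> derived GL2 G"
proof -
  have G: "subgroup G GL2"
    using closed by (simp add: closed_subgroup_def)
  \<comment> \<open>The power \<open>a = 4 * n\<close> is large enough: the brackets below give
    first-order terms at level \<open>2 * a + (2 * n + 1) = 10 * n + 1\<close> with error
    \<open>2 ^ (3 * a)\<close>, and \<open>10 * n + 2 \<le> 12 * n\<close> for positive
    \<open>n\<close>.\<close>
  let ?T = "tangent (derived GL2 G) (2 * (4 * n)) (4 * n)"
  have T: "open_submodule (4 * n) ?T"
    using group.derived_is_subgroup[OF group_GL2 subgroup.subset[OF G]]
    by (rule open_submodule_tangent) simp
  have Theta: "\<exists>t. \<not> 2 dvd t \<and> mat t + Theta g = g" "trace (Theta g) = 0" "2 dvd Theta g $ i $ j"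
    if "g \<in> G" for g i j
    using Theta_decomposition[of g] that cong by (auto simp: congruence_conditions_iff)
  have brackets: "bracket (Theta g) (Theta h) \<in> ?T" if g: "g \<in> G" and h: "h \<in> G" for g h
  proof -
    have "\<exists>s u. \<not> 2 dvd s \<and> \<not> 2 dvd u \<and> mat s + scale (2 ^ (4 * n) * u) (Theta k) \<in> G" if k: "k \<in> G" for k
    proof -
      obtain t where "\<not> 2 dvd t" "mat t + Theta k = k"
        using Theta(1)[OF k] by blast
      then show ?thesis
        using k Theta(2,3)[OF k] by (intro iterated_square[OF G, of t]) auto
    qed
    from this[OF g] this[OF h] show ?thesis
      using bracket_in_tangent[OF G] by blast
  qed
  have "Theta ` G \<subseteq> carrier sl2"
    using Theta(2) by (auto simp: carrier_sl2)
  note bracket_L = bracket_L_subset_open_submodule[OF T this brackets]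
  have bracket: "bracket (scale (2 ^ n) X) (scale (2 ^ n) Y) \<in> ?T" if "trace X = 0" "trace Y = 0" for X Y
    using L that by (intro bracket_L) (auto simp: carrier_sl2)
  have "\<exists>g\<in>derived GL2 G. mcong (Suc (10 * n + 1)) g (mat 1 + scale (2 ^ (10 * n + 1)) X)"
    if X: "trace X = 0" for X
  proof -
    define p q r where "p = X$1$1" and "q = X$1$2" and "r = X$2$1"
    have [simp]: "X$2$2 = - p"
      using X by (simp add: trace_2 p_def eq_neg_iff_add_eq_0 add.commute)
    \<comment> \<open>The factor 2 beyond \<open>2 ^ (2 * n)\<close> comes from \<open>[h, e] = 2 e\<close> and \<open>[f, h] = 2 f\<close>.\<close>
    let ?Z = "\<lambda>X Y. bracket (scale (2 ^ n) X) (scale (2 ^ n) Y)"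
    let ?E = "\<lambda>b. mat2 0 b 0 0" and ?F = "\<lambda>c. mat2 0 0 c 0" and ?H = "mat2 1 0 0 (- 1)"
    have "?Z (?E (2 * p)) (?F 1) + (?Z ?H (?E q) + ?Z (?F r) ?H) \<in> ?T"
      using T bracket unfolding open_submodule_def by (simp add: trace_2)
    moreover have "?Z (?E (2 * p)) (?F 1) + (?Z ?H (?E q) + ?Z (?F r) ?H) = scale (2 ^ (2 * n + 1)) X"
      unfolding mult_2[of n] power_add
      by (simp add: bracket_def mat2_simps p_def[symmetric] q_def[symmetric] r_def[symmetric] algebra_simps)
    ultimately obtain g where g: "g \<in> derived GL2 G"
      "mcong (2 * (4 * n) + 4 * n) g (mat 1 + scale (2 ^ (2 * (4 * n))) (scale (2 ^ (2 * n + 1)) X))"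
      unfolding tangent_def by auto
    have "scale (2 ^ (2 * (4 * n))) (scale (2 ^ (2 * n + 1)) X) = scale (2 ^ (2 * (4 * n) + (2 * n + 1))) X"
      by (simp only: power_add) (simp add: matrix_2_eq_iff ac_simps)
    moreover have "2 * (4 * n) + (2 * n + 1) = 10 * n + 1"
      by simp
    ultimately have "mcong (2 * (4 * n) + 4 * n) g (mat 1 + scale (2 ^ (10 * n + 1)) X)"
      using g(2) by (simp only:)
    then have "mcong (Suc (10 * n + 1)) g (mat 1 + scale (2 ^ (10 * n + 1)) X)"
      by (rule mcong_mono) (use \<open>n > 0\<close> in simp)
    then show ?thesis
      using g(1) by blast
  qed
  then have "B2 (10 * n + 1) \<subseteq> derived GL2 G"
    using \<open>n > 0\<close> by (intro B2_subset_derived closed) auto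
  moreover have "B2 (12 * n + 2) \<subseteq> B2 (10 * n + 1)"
    by (rule B2_mono) simp
  ultimately show ?thesis by blast
qed

section \<open>The congruence kernel\<close>

lemma mcong_det: "mcong m A B \<Longrightarrow> 2 ^ m dvd det A - det B"
proof -
  assume "mcong m A B"
  then obtain C where "A = B + scale (2 ^ m) C"
    unfolding mcong_iff by blast
  then have "det A - det B = 2 ^ m * (B$1$1 * C$2$2 + C$1$1 * B$2$2 - B$1$2 * C$2$1 - C$1$2 * B$2$1 +
      2 ^ m * det C)"
    by (simp add: det_2 algebra_simps)
  then show ?thesis by simp
qed

lemma closed_subgroup_congruence_kernel:
  assumes "closed_subgroup GL2 G"
  shows "closed_subgroup GL2 (congruence_kernel G)"
proof -
  have G: "subgroup G GL2"
    using assms by (simp add: closed_subgroup_def)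
  have inv: "mcong 2 (inv\<^bsub>GL2\<^esub> g) (mat 1)" "2 ^ 3 dvd det (inv\<^bsub>GL2\<^esub> g) - 1"
    if g: "g \<in> G" "mcong 2 g (mat 1)" "2 ^ 3 dvd det g - 1" for g
  proof -
    have carrier: "g \<in> carrier GL2"
      using subgroup.mem_carrier[OF G g(1)] .
    have "mcong 2 (inv\<^bsub>GL2\<^esub> g ** g) (inv\<^bsub>GL2\<^esub> g ** mat 1)"
      using g(2) by (rule mcong_mult[OF mcong_refl])
    then show "mcong 2 (inv\<^bsub>GL2\<^esub> g) (mat 1)"
      by (simp add: inv_GL2(2)[OF carrier] mcong_sym)
    have "det (inv\<^bsub>GL2\<^esub> g) - 1 = (det g - 1) * - det (inv\<^bsub>GL2\<^esub> g)"
      using det_inv_GL2[OF carrier] by (simp add: algebra_simps)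
    then show "2 ^ 3 dvd det (inv\<^bsub>GL2\<^esub> g) - 1"
      using dvd_mult2[OF g(3)] by metis
  qed
  have "2 ^ 3 dvd det g * det h - 1" if "2 ^ 3 dvd det g - 1" "2 ^ 3 dvd det h - 1" for g h :: "padic2 ^ 2 ^ 2"
  proof -
    have "det g * det h - 1 = (det g - 1) * det h + (det h - 1)"
      by (simp add: algebra_simps)
    then show ?thesis
      using that by (metis dvd_add dvd_mult2)
  qed
  moreover have "mcong 2 (g ** h) (mat 1)" if "mcong 2 g (mat 1)" "mcong 2 h (mat 1)" for g h
    using mcong_mult[OF that] by simp
  ultimately have "subgroup (congruence_kernel G) GL2"
    using inv subgroup.one_closed[OF G] subgroup.m_closed[OF G] subgroup.m_inv_closed[OF G] subgroup.mem_carrier[OF G]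
    by (intro group.subgroupI[OF group_GL2]) (auto simp: congruence_kernel_eq det_mul intro: exI[of _ "mat 1"])
  moreover have "closedin (top_of_set (carrier GL2)) (congruence_kernel G)"
  proof -
    obtain T where T: "closed T" "G = carrier GL2 \<inter> T"
      using assms unfolding closed_subgroup_def closedin_closed by blast
    let ?S = "{g :: padic2 ^ 2 ^ 2. mcong 2 g (mat 1) \<and> 2 ^ 3 dvd det g - 1}"
    \<comment> \<open>Both conditions depend only on the matrix modulo 8.\<close>
    have "closed ?S"
    proof (rule closed_if_mcong_invariant[of _ 3])
      fix A B :: "padic2 ^ 2 ^ 2" assume A: "A \<in> ?S" and AB: "mcong 3 A B"
      have "mcong 2 B A"
        using mcong_mono[OF mcong_sym[OF AB], of 2] by simp
      then have "mcong 2 B (mat 1)"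
        using A mcong_trans by blast
      moreover have "2 ^ 3 dvd (det B - det A) + (det A - 1)"
        using mcong_det[OF mcong_sym[OF AB]] A by (intro dvd_add) auto
      ultimately show "B \<in> ?S" by simp
    qed
    moreover have "congruence_kernel G = carrier GL2 \<inter> (T \<inter> ?S)"
      by (auto simp: congruence_kernel_eq T(2))
    ultimately show ?thesis
      unfolding closedin_closed using closed_Int[OF T(1)] by blast
  qed
  ultimately show ?thesis
    by (simp add: closed_subgroup_def)
qed

lemma congruence_conditions_congruence_kernel:
  assumes "subgroup G GL2"
  shows "congruence_conditions (congruence_kernel G)"
  using subgroup.one_closed[OF assms] by (auto simp: congruence_conditions_iff congruence_kernel_eq intro: exI[of _ "mat 1"])

text \<open>
  The entries of a matrix modulo 4 together with its determinant \<open>e\<close> modulo 8, which is odd and is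
  determined modulo 4 by the entries.  There are \<open>96 = |GL\<^sub>2(\<int>/4)|\<close> matrices and two lifts of each
  determinant.
\<close>

definition residue_signatures :: "(int \<times> int \<times> int \<times> int \<times> int) list" where
  "residue_signatures =
     filter (\<lambda>(a, b, c, d, e). e mod 4 = (a * d - b * c) mod 4)
       (let r = [0..3] in List.product r (List.product r (List.product r (List.product r [1, 3, 5, 7]))))"

lemma length_residue_signatures: "length residue_signatures = 192"
  by code_simp

definition residue_signature :: "padic2 ^ 2 ^ 2 \<Rightarrow> int \<times> int \<times> int \<times> int \<times> int" where
  "residue_signature g =
     (residue (g$1$1) 2, residue (g$1$2) 2, residue (g$2$1) 2, residue (g$2$2) 2, residue (det g) 3)"

lemma residue_signature_in_signatures:
  assumes "g \<in> carrier GL2"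
  shows "residue_signature g \<in> set residue_signatures"
proof -
  have "det g dvd 1"
    using det_inv_GL2[OF assms] by (metis dvdI)
  then have "residue (det g) 3 mod 2 \<noteq> 0"
    using power2_dvd_iff[of 1 "det g"] residue_mod_le[of 1 3 "det g"] by (simp add: dvd_one_iff_odd)
  moreover have "residue (det g) 3 \<in> {0..<8}"
    using residue_range[of "det g" 3] by simp
  ultimately have "residue (det g) 3 \<in> {1, 3, 5, 7}"
    by auto presburger
  moreover have "residue (det g) 3 mod 4 = residue (det g) 2"
    using residue_mod_le[of 2 3 "det g"] by simp
  then have "residue (det g) 3 mod 4 =
      (residue (g$1$1) 2 * residue (g$2$2) 2 - residue (g$1$2) 2 * residue (g$2$1) 2) mod 4"
    by (simp add: det_2 residue_diff residue_mult mod_simps)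
  moreover have "residue (g$i$j) 2 \<in> {0..3}" for i j
    using residue_range[of "g$i$j" 2] by simp
  ultimately show ?thesis
    by (simp only: residue_signature_def residue_signatures_def Let_def set_filter set_product set_upto
        mem_Collect_eq mem_Sigma_iff prod.case list.set)
qed

lemma residue_signature_eq_iff:
  "residue_signature g = residue_signature h \<longleftrightarrow> mcong 2 g h \<and> 2 ^ 3 dvd det g - det h"
  unfolding residue_signature_def mcong_def all_2_matrix power2_dvd_diff_iff
    vector_minus_component by auto

text \<open>If \<open>g\<close> and \<open>h\<close> have equal signatures, then
  \<open>h ** inv g\<close> is trivial modulo 4 and has determinant 1 modulo 8. Cosets are therefore
  determined by signatures, of which there are 192.\<close>

lemma rcosets_congruence_kernel:
  assumes G: "closed_subgroup GL2 G"
  shows "finite (rcosets\<^bsub>GL2\<lparr>carrier := G\<rparr>\<^esub> congruence_kernel G) \<and>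
    card (rcosets\<^bsub>GL2\<lparr>carrier := G\<rparr>\<^esub> congruence_kernel G) \<le> 192"
proof -
  let ?H = "congruence_kernel G"
  interpret group "GL2 :: (padic2 ^ 2 ^ 2) monoid" by (rule group_GL2)
  have sub: "subgroup G GL2"
    using G by (simp add: closed_subgroup_def)
  have H: "subgroup ?H GL2"
    using closed_subgroup_congruence_kernel[OF G] by (simp add: closed_subgroup_def)
  have coset_eq: "?H #>\<^bsub>GL2\<^esub> g = ?H #>\<^bsub>GL2\<^esub> h"
    if g: "g \<in> G" and h: "h \<in> G" and "residue_signature h = residue_signature g" for g h
  proof -
    have cong: "mcong 2 h g" "2 ^ 3 dvd det h - det g"
      using that by (simp_all add: residue_signature_eq_iff)
    have carrier: "g \<in> carrier GL2"
      using subgroup.mem_carrier[OF sub g] .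
    let ?k = "h ** inv\<^bsub>GL2\<^esub> g"
    have "?k \<in> G"
      using subgroup.m_closed[OF sub h subgroup.m_inv_closed[OF sub g]] by simp
    moreover have "mcong 2 ?k (g ** inv\<^bsub>GL2\<^esub> g)"
      using cong(1) by (rule mcong_mult) simp
    moreover have "det ?k - 1 = (det h - det g) * det (inv\<^bsub>GL2\<^esub> g)"
      using det_inv_GL2[OF carrier] by (simp add: det_mul algebra_simps)
    ultimately have "?k \<in> ?H"
      using dvd_mult2[OF cong(2)] by (simp add: congruence_kernel_eq inv_GL2(1)[OF carrier])
    moreover have "h = ?k ** g"
      by (simp only: matrix_mul_assoc[symmetric] inv_GL2(2)[OF carrier] matrix_mul_rid)
    ultimately have "h \<in> ?H #>\<^bsub>GL2\<^esub> g"
      unfolding r_coset_def by auto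
    then show ?thesis
      using carrier H by (rule repr_independence)
  qed
  \<comment> \<open>For a signature that does not occur in \<open>G\<close> the choice is arbitrary,
    which only enlarges the bounding set.\<close>
  define c where "c s = ?H #>\<^bsub>GL2\<^esub> (SOME g. g \<in> G \<and> residue_signature g = s)" for s
  have "?H #>\<^bsub>GL2\<^esub> g = c (residue_signature g)" if "g \<in> G" for g
  proof -
    let ?P = "\<lambda>h. h \<in> G \<and> residue_signature h = residue_signature g"
    have "?P (SOME h. ?P h)"
      using that by (intro someI[of ?P g]) simp
    then show ?thesis
      unfolding c_def using coset_eq[OF that] by blast
  qed
  moreover have "rcosets\<^bsub>GL2\<lparr>carrier := G\<rparr>\<^esub> ?H = (\<lambda>g. ?H #>\<^bsub>GL2\<^esub> g) ` G"
    by (auto simp: RCOSETS_def r_coset_def)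
  ultimately have "rcosets\<^bsub>GL2\<lparr>carrier := G\<rparr>\<^esub> ?H \<subseteq> c ` set residue_signatures"
    using residue_signature_in_signatures subgroup.mem_carrier[OF sub] by auto
  moreover have "card (c ` set residue_signatures) \<le> 192"
    using card_image_le[of "set residue_signatures" c] card_length[of residue_signatures]
    by (simp add: length_residue_signatures)
  ultimately show ?thesis
    by (meson List.finite_set card_mono finite_imageI finite_subset le_trans)
qed

theorem theorem5p1:
  fixes G :: "(padic2 ^ 2 ^ 2) set"
  assumes "closed_subgroup GL2 G"
  shows
    "(congruence_conditions G \<longrightarrow>
        (\<forall>n::nat. n > 0 \<longrightarrow>
           map_matrix ((*) (2 ^ n)) ` carrier sl2 \<subseteq> L G \<longrightarrow>
           B2 (12 * n + 2) \<subseteq> derived GL2 G)) \<and>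
     (let H = congruence_kernel G;
          cosets = rcosets\<^bsub>GL2\<lparr>carrier := G\<rparr>\<^esub> H
      in finite cosets \<and> card cosets \<le> 192 \<and>
         closed_subgroup GL2 H \<and> congruence_conditions H)"
  using assms derived_contains_B2[OF assms] rcosets_congruence_kernel[OF assms]
    closed_subgroup_congruence_kernel[OF assms] congruence_conditions_congruence_kernel
  by (simp add: Let_def closed_subgroup_def)

end
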